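(* For every set of formulas $\Gamma\cup\{\varphi\}\subseteq \mathbf{F}(\Sigma_{\mathbf{bI}},\mathcal V)$: $\Gamma\vdash_{\mathbf{bI}}\varphi$ if and only if $\Gamma\vDash_{\mathbf{bI}}\varphi$.
   Context: Let $\mathcal V$ be a countable set of propositional variables and $\Sigma_{\mathbf{bI}}=\{\vee,\wedge,\rightarrow,\uparrow\}$, all connectives binary ($\alpha\uparrow\beta$ reads "$\alpha$ is incompatible with $\beta$"); $\mathbf F(\Sigma_{\mathbf{bI}},\mathcal V)$ is the set of formulas. The logic $\mathbf{bI}$ is the Hilbert calculus whose only inference rule is Modus Ponens and whose axioms are all instances (with arbitrary formulas) of: (1) $\alpha\to(\beta\to\alpha)$; (2) $(\alpha\to(\beta\to\gamma))\to((\alpha\to\beta)\to(\alpha\to\gamma))$; (3) $\alpha\to(\beta\to(\alpha\wedge\beta))$; (4) $(\alpha\wedge\beta)\to\alpha$; (5) $(\alpha\wedge\beta)\to\beta$; (6) $\alpha\to(\alpha\vee\beta)$; (7) $\beta\to(\alpha\vee\beta)$; (8) $(\alpha\to\gamma)\to((\beta\to\gamma)\to((\alpha\vee\beta)\to\gamma))$; (9) $(\alpha\to\beta)\vee\alpha$; (Ip) $(\alpha\uparrow\beta)\to(\alpha\to(\beta\to\gamma))$; (Comm) $(\alpha\uparrow\beta)\to(\beta\uparrow\alpha)$. $\Gamma\vdash_{\mathbf{bI}}\varphi$ means that there is a finite derivation of $\varphi$ from premises in $\Gamma$ in this calculus. A bivaluation for $\mathbf{bI}$ is a map $\nu:\mathbf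 F(\Sigma_{\mathbf{bI}},\mathcal V)\to\{0,1\}$ such that for all formulas $\alpha,\beta$: $\nu(\alpha\vee\beta)=1$ iff $\nu(\alpha)=1$ or $\nu(\beta)=1$; $\nu(\alpha\wedge\beta)=1$ iff $\nu(\alpha)=\nu(\beta)=1$; $\nu(\alpha\to\beta)=1$ iff $\nu(\alpha)=0$ or $\nu(\beta)=1$; if $\nu(\alpha\uparrow\beta)=1$ then $\nu(\alpha)=0$ or $\nu(\beta)=0$; $\nu(\alpha\uparrow\beta)=\nu(\beta\uparrow\alpha)$. $\Gamma\vDash_{\mathbf{bI}}\varphi$ means: for every bivaluation $\nu$ for $\mathbf{bI}$, if $\nu(\gamma)=1$ for all $\gamma\in\Gamma$ then $\nu(\varphi)=1$. *)

theory Defs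
  imports Main "HOL-Library.Countable"
begin

datatype 'v fm =
    Var 'v
  | Or "'v fm" "'v fm"      (infixr \<open>\<^bold>\<or>\<close> 63)
  | And "'v fm" "'v fm"     (infixr \<open>\<^bold>\<and>\<close> 64)
  | Imp "'v fm" "'v fm"     (infixr \<open>\<^bold>\<rightarrow>\<close> 62)
  | Incomp "'v fm" "'v fm"  (infix \<open>\<^bold>\<up>\<close> 65)

inductive_set bI_axioms :: "'v fm set" where
  Ax1: "\<alpha> \<^bold>\<rightarrow> (\<beta> \<^bold>\<rightarrow> \<alpha>) \<in> bI_axioms"
| Ax2: "(\<alpha> \<^bold>\<rightarrow> (\<beta> \<^bold>\<rightarrow> \<gamma>)) \<^bold>\<rightarrow> ((\<alpha> \<^bold>\<rightarrow> \<beta>) \<^bold>\<rightarrow> (\<alpha> \<^bold>\<rightarrow> \<gamma>)) \<in> bI_axioms"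
| Ax3: "\<alpha> \<^bold>\<rightarrow> (\<beta> \<^bold>\<rightarrow> (\<alpha> \<^bold>\<and> \<beta>)) \<in> bI_axioms"
| Ax4: "(\<alpha> \<^bold>\<and> \<beta>) \<^bold>\<rightarrow> \<alpha> \<in> bI_axioms"
| Ax5: "(\<alpha> \<^bold>\<and> \<beta>) \<^bold>\<rightarrow> \<beta> \<in> bI_axioms"
| Ax6: "\<alpha> \<^bold>\<rightarrow> (\<alpha> \<^bold>\<or> \<beta>) \<in> bI_axioms"
| Ax7: "\<beta> \<^bold>\<rightarrow> (\<alpha> \<^bold>\<or> \<beta>) \<in> bI_axioms"
| Ax8: "(\<alpha> \<^bold>\<rightarrow> \<gamma>) \<^bold>\<rightarrow> ((\<beta> \<^bold>\<rightarrow> \<gamma>) \<^bold>\<rightarrow> ((\<alpha> \<^bold>\<or> \<beta>) \<^bold>\<rightarrow> \<gamma>)) \<in> bI_axioms"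
| Ax9: "(\<alpha> \<^bold>\<rightarrow> \<beta>) \<^bold>\<or> \<alpha> \<in> bI_axioms"
| Ip: "(\<alpha> \<^bold>\<up> \<beta>) \<^bold>\<rightarrow> (\<alpha> \<^bold>\<rightarrow> (\<beta> \<^bold>\<rightarrow> \<gamma>)) \<in> bI_axioms"
| Comm: "(\<alpha> \<^bold>\<up> \<beta>) \<^bold>\<rightarrow> (\<beta> \<^bold>\<up> \<alpha>) \<in> bI_axioms"

definition bI_derivation :: "'v fm set \<Rightarrow> 'v fm list \<Rightarrow> bool" where
  "bI_derivation \<Gamma> \<delta> \<longleftrightarrow>
     (\<forall>i<length \<delta>. \<delta> ! i \<in> bI_axioms \<or> \<delta> ! i \<in> \<Gamma> \<or>
        (\<exists>j<i. \<exists>k<i. \<delta> ! k = \<delta> ! j \<^bold>\<rightarrow> \<delta> ! i))"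

definition bI_derivable :: "'v fm set \<Rightarrow> 'v fm \<Rightarrow> bool" (infix \<open>\<turnstile>\<^sub>b\<^sub>I\<close> 50) where
  "\<Gamma> \<turnstile>\<^sub>b\<^sub>I \<phi> \<longleftrightarrow> (\<exists>\<delta>. \<delta> \<noteq> [] \<and> bI_derivation \<Gamma> \<delta> \<and> last \<delta> = \<phi>)"

(* The truth values 1 and 0 are rendered as True and False. *)
definition bI_bivaluation :: "('v fm \<Rightarrow> bool) \<Rightarrow> bool" where
  "bI_bivaluation \<nu> \<longleftrightarrow>
     (\<forall>\<alpha> \<beta>. \<nu> (\<alpha> \<^bold>\<or> \<beta>) \<longleftrightarrow> \<nu> \<alpha> \<or> \<nu> \<beta>) \<and>
     (\<forall>\<alpha> \<beta>. \<nu> (\<alpha> \<^bold>\<and> \<beta>) \<longleftrightarrow> \<nu> \<alpha> \<and> \<nu> \<beta>) \<and>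
     (\<forall>\<alpha> \<beta>. \<nu> (\<alpha> \<^bold>\<rightarrow> \<beta>) \<longleftrightarrow> \<not> \<nu> \<alpha> \<or> \<nu> \<beta>) \<and>
     (\<forall>\<alpha> \<beta>. \<nu> (\<alpha> \<^bold>\<up> \<beta>) \<longrightarrow> \<not> \<nu> \<alpha> \<or> \<not> \<nu> \<beta>) \<and>
     (\<forall>\<alpha> \<beta>. \<nu> (\<alpha> \<^bold>\<up> \<beta>) = \<nu> (\<beta> \<^bold>\<up> \<alpha>))"

definition bI_entails :: "'v fm set \<Rightarrow> 'v fm \<Rightarrow> bool" (infix \<open>\<Turnstile>\<^sub>b\<^sub>I\<close> 50) where
  "\<Gamma> \<Turnstile>\<^sub>b\<^sub>I \<phi> \<longleftrightarrow> (\<forall>\<nu>. bI_bivaluation \<nu> \<longrightarrow> (\<forall>\<gamma>\<in>\<Gamma>. \<nu> \<gamma>) \<longrightarrow> \<nu> \<phi>)"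

end

theory Submission
  imports Defs
begin

text \<open>
  Soundness is an induction on derivations. For completeness, suppose that \<open>\<phi>\<close> is not derivable from
  \<open>\<Gamma>\<close>. Since a derivation inspects only finitely many premises, Zorn's lemma extends \<open>\<Gamma>\<close> to a set
  \<open>\<Delta>\<close> that is maximal among the sets from which \<open>\<phi>\<close> is not derivable (lemma
  \<open>relatively_maximal_extension\<close>), and the characteristic function of \<open>\<Delta>\<close> is then a bivaluation that
  refutes \<open>\<Gamma> \<Turnstile>\<^sub>b\<^sub>I \<phi>\<close> (lemma \<open>bivaluation_of_relatively_maximal\<close>).

  Negation and falsum are not among the connectives; the unprovable formula \<open>\<phi>\<close> takes the place of
  falsum, and implying \<open>\<phi>\<close> that of negation. By maximality and the deduction theorem,
  \<open>\<alpha> \<notin> \<Delta>\<close> is the same as \<open>\<Delta> \<turnstile>\<^sub>b\<^sub>I \<alpha> \<^bold>\<rightarrow> \<phi>\<close>. Proof by cases (Ax8) makes \<open>\<Delta>\<close> prime; primeness applied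
  to \<open>(\<alpha> \<^bold>\<rightarrow> \<beta>) \<^bold>\<or> \<alpha>\<close> (Ax9) makes the implication of \<open>\<Delta>\<close> classical; and Ip forbids \<open>\<alpha>\<close>, \<open>\<beta>\<close> and
  \<open>\<alpha> \<^bold>\<up> \<beta>\<close> to lie together in \<open>\<Delta>\<close>, since they would yield \<open>\<phi>\<close>.
\<close>

section \<open>Derivations\<close>

lemma bI_derivation_append:
  assumes "bI_derivation \<Gamma> \<delta>" "bI_derivation \<Gamma> \<epsilon>"
  shows "bI_derivation \<Gamma> (\<delta> @ \<epsilon>)"
  unfolding bI_derivation_def
proof (intro allI impI)
  fix i assume i: "i < length (\<delta> @ \<epsilon>)"
  let ?P = "\<lambda>\<zeta> i. \<zeta> ! i \<in> bI_axioms \<or> \<zeta> ! i \<in> \<Gamma> \<or> (\<exists>j<i. \<exists>k<i. \<zeta> ! k = \<zeta> ! j \<^bold>\<rightarrow> \<zeta> ! i)"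
  show "?P (\<delta> @ \<epsilon>) i"
  proof (cases "i < length \<delta>")
    case True
    then have "?P \<delta> i" using assms(1) by (simp add: bI_derivation_def)
    moreover have "(\<delta> @ \<epsilon>) ! j = \<delta> ! j" if "j \<le> i" for j
      using that True by (simp add: nth_append)
    ultimately show ?thesis by (metis less_imp_le order_refl)
  next
    case False
    define m where "m = i - length \<delta>"
    have im: "i = length \<delta> + m" and "m < length \<epsilon>"
      using False i by (auto simp: m_def)
    then have "?P \<epsilon> m" using assms(2) by (simp add: bI_derivation_def)
    moreover have "(\<delta> @ \<epsilon>) ! (length \<delta> + j) = \<epsilon> ! j" for j by simp
    ultimately show ?thesis unfolding im by (metis nat_add_left_cancel_less)
  qed
qed

lemma bI_derivation_snoc:
  assumes "bI_derivation \<Gamma> \<delta>"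
    and "\<alpha> \<in> bI_axioms \<or> \<alpha> \<in> \<Gamma> \<or> (\<exists>\<beta>\<in>set \<delta>. \<beta> \<^bold>\<rightarrow> \<alpha> \<in> set \<delta>)"
  shows "bI_derivation \<Gamma> (\<delta> @ [\<alpha>])"
  unfolding bI_derivation_def
proof (intro allI impI)
  fix i assume i: "i < length (\<delta> @ [\<alpha>])"
  let ?P = "\<lambda>\<zeta> i. \<zeta> ! i \<in> bI_axioms \<or> \<zeta> ! i \<in> \<Gamma> \<or> (\<exists>j<i. \<exists>k<i. \<zeta> ! k = \<zeta> ! j \<^bold>\<rightarrow> \<zeta> ! i)"
  show "?P (\<delta> @ [\<alpha>]) i"
  proof (cases "i < length \<delta>")
    case True
    then have "?P \<delta> i" using assms(1) by (simp add: bI_derivation_def)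
    moreover have "(\<delta> @ [\<alpha>]) ! j = \<delta> ! j" if "j \<le> i" for j
      using that True by (simp add: nth_append)
    ultimately show ?thesis by (metis less_imp_le order_refl)
  next
    case False
    then have "i = length \<delta>" using i by simp
    with assms(2) show ?thesis
      by (auto simp: in_set_conv_nth) (metis nth_append)
  qed
qed

lemma bI_derivable_single:
  assumes "\<alpha> \<in> bI_axioms \<or> \<alpha> \<in> \<Gamma>"
  shows "\<Gamma> \<turnstile>\<^sub>b\<^sub>I \<alpha>"
  unfolding bI_derivable_def
  by (rule exI[of _ "[\<alpha>]"]) (use assms in \<open>simp add: bI_derivation_def\<close>)

lemma bI_axiom: "\<alpha> \<in> bI_axioms \<Longrightarrow> \<Gamma> \<turnstile>\<^sub>b\<^sub>I \<alpha>"
  by (simp add: bI_derivable_single)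

lemma bI_premise: "\<alpha> \<in> \<Gamma> \<Longrightarrow> \<Gamma> \<turnstile>\<^sub>b\<^sub>I \<alpha>"
  by (simp add: bI_derivable_single)

lemma bI_modus_ponens:
  assumes "\<Gamma> \<turnstile>\<^sub>b\<^sub>I \<alpha> \<^bold>\<rightarrow> \<beta>" "\<Gamma> \<turnstile>\<^sub>b\<^sub>I \<alpha>"
  shows "\<Gamma> \<turnstile>\<^sub>b\<^sub>I \<beta>"
proof -
  obtain \<delta> where \<delta>: "\<delta> \<noteq> []" "bI_derivation \<Gamma> \<delta>" "last \<delta> = \<alpha> \<^bold>\<rightarrow> \<beta>"
    using assms(1) by (auto simp: bI_derivable_def)
  obtain \<epsilon> where \<epsilon>: "\<epsilon> \<noteq> []" "bI_derivation \<Gamma> \<epsilon>" "last \<epsilon> = \<alpha>"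
    using assms(2) by (auto simp: bI_derivable_def)
  have "\<alpha> \<^bold>\<rightarrow> \<beta> \<in> set (\<delta> @ \<epsilon>)" "\<alpha> \<in> set (\<delta> @ \<epsilon>)"
    using \<delta> \<epsilon> by (metis Un_iff last_in_set set_append)+
  then have "bI_derivation \<Gamma> ((\<delta> @ \<epsilon>) @ [\<beta>])"
    using \<delta>(2) \<epsilon>(2) by (intro bI_derivation_snoc bI_derivation_append) auto
  then show ?thesis
    unfolding bI_derivable_def by (intro exI[of _ "(\<delta> @ \<epsilon>) @ [\<beta>]"]) simp
qed

text \<open>
  This rule and the three lemmas above present derivability as the least relation that contains the
  axioms and the premises and is closed under Modus Ponens; nothing below depends on derivations being
  lists.
\<close>

lemma bI_derivable_induct [consumes 1, case_names axiom premise modus_ponens]: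
  assumes "\<Gamma> \<turnstile>\<^sub>b\<^sub>I \<phi>"
    and ax: "\<And>\<alpha>. \<alpha> \<in> bI_axioms \<Longrightarrow> P \<alpha>"
    and prem: "\<And>\<alpha>. \<alpha> \<in> \<Gamma> \<Longrightarrow> P \<alpha>"
    and mp: "\<And>\<alpha> \<beta>. P (\<alpha> \<^bold>\<rightarrow> \<beta>) \<Longrightarrow> P \<alpha> \<Longrightarrow> P \<beta>"
  shows "P \<phi>"
proof -
  obtain \<delta> where \<delta>: "\<delta> \<noteq> []" "bI_derivation \<Gamma> \<delta>" "last \<delta> = \<phi>"
    using assms(1) by (auto simp: bI_derivable_def)
  have "P (\<delta> ! i)" if "i < length \<delta>" for i
    using that
  proof (induction i rule: less_induct)
    case (less i)
    consider "\<delta> ! i \<in> bI_axioms" | "\<delta> ! i \<in> \<Gamma>"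
      | j k where "j < i" "k < i" "\<delta> ! k = \<delta> ! j \<^bold>\<rightarrow> \<delta> ! i"
      using \<delta>(2) less.prems unfolding bI_derivation_def by blast
    then show ?case
    proof cases
      case 3
      then have "P (\<delta> ! j)" "P (\<delta> ! j \<^bold>\<rightarrow> \<delta> ! i)"
        using less.IH[of j] less.IH[of k] less.prems by auto
      then show ?thesis by (rule mp[rotated])
    qed (auto intro: ax prem)
  qed
  then have "P (\<delta> ! (length \<delta> - 1))" using \<delta>(1) by simp
  then show ?thesis using \<delta>(1,3) by (simp add: last_conv_nth)
qed

theorem bI_soundness:
  assumes "\<Gamma> \<turnstile>\<^sub>b\<^sub>I \<phi>"
  shows "\<Gamma> \<Turnstile>\<^sub>b\<^sub>I \<phi>"
  unfolding bI_entails_def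
proof (intro allI impI)
  fix \<nu> assume \<nu>: "bI_bivaluation \<nu>" and \<Gamma>: "\<forall>\<gamma>\<in>\<Gamma>. \<nu> \<gamma>"
  from assms show "\<nu> \<phi>"
  proof (induction rule: bI_derivable_induct)
    case (axiom \<alpha>)
    then show ?case
      using \<nu> by cases (auto simp: bI_bivaluation_def)
  next
    case (premise \<alpha>)
    then show ?case using \<Gamma> by blast
  next
    case (modus_ponens \<alpha> \<beta>)
    then show ?case using \<nu> by (auto simp: bI_bivaluation_def)
  qed
qed

lemma bI_weaken: "\<Gamma> \<turnstile>\<^sub>b\<^sub>I \<alpha> \<Longrightarrow> \<Gamma> \<turnstile>\<^sub>b\<^sub>I \<beta> \<^bold>\<rightarrow> \<alpha>"
  using Ax1 bI_axiom bI_modus_ponens by blast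

lemma bI_imp_refl: "\<Gamma> \<turnstile>\<^sub>b\<^sub>I \<alpha> \<^bold>\<rightarrow> \<alpha>"
proof -
  have "\<Gamma> \<turnstile>\<^sub>b\<^sub>I (\<alpha> \<^bold>\<rightarrow> ((\<alpha> \<^bold>\<rightarrow> \<alpha>) \<^bold>\<rightarrow> \<alpha>)) \<^bold>\<rightarrow> ((\<alpha> \<^bold>\<rightarrow> (\<alpha> \<^bold>\<rightarrow> \<alpha>)) \<^bold>\<rightarrow> (\<alpha> \<^bold>\<rightarrow> \<alpha>))"
    by (rule bI_axiom[OF Ax2])
  then show ?thesis
    by (meson Ax1 bI_axiom bI_modus_ponens)
qed

lemma bI_deduction:
  assumes "insert \<alpha> \<Gamma> \<turnstile>\<^sub>b\<^sub>I \<beta>"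
  shows "\<Gamma> \<turnstile>\<^sub>b\<^sub>I \<alpha> \<^bold>\<rightarrow> \<beta>"
  using assms
proof (induction rule: bI_derivable_induct)
  case (axiom \<beta>)
  then show ?case by (intro bI_weaken bI_axiom)
next
  case (premise \<beta>)
  then show ?case using bI_imp_refl bI_weaken bI_premise by blast
next
  case (modus_ponens \<beta> \<gamma>)
  then show ?case using bI_axiom[OF Ax2] bI_modus_ponens by blast
qed

section \<open>Relatively maximal sets\<close>

text \<open>
  Only finitely many premises occur in a derivation, so they all lie in one member of the chain. The
  induction over derivations makes this precise without finite sets: Modus Ponens combines two members
  of the chain, and the larger one derives the conclusion.
\<close>

lemma bI_derivable_Union_chain:
  assumes chain: "subset.chain A C" and ne: "C \<noteq> {}" and der: "\<Union>C \<turnstile>\<^sub>b\<^sub>I \<phi>"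
  shows "\<exists>\<Delta>\<in>C. \<Delta> \<turnstile>\<^sub>b\<^sub>I \<phi>"
proof -
  have mono: "\<Delta> \<turnstile>\<^sub>b\<^sub>I \<alpha>" if "\<Theta> \<turnstile>\<^sub>b\<^sub>I \<alpha>" "\<Theta> \<subseteq> \<Delta>" for \<Theta> \<Delta> :: "'a fm set" and \<alpha>
    using that(1)
    by (induction rule: bI_derivable_induct)
       (use that(2) in \<open>auto intro: bI_axiom bI_premise bI_modus_ponens\<close>)
  from der show ?thesis
  proof (induction rule: bI_derivable_induct)
    case (axiom \<alpha>)
    then show ?case using ne bI_axiom by blast
  next
    case (premise \<alpha>)
    then show ?case using bI_premise by blast
  next
    case (modus_ponens \<alpha> \<beta>)
    then obtain \<Theta> \<Delta> where D: "\<Theta> \<in> C" "\<Theta> \<turnstile>\<^sub>b\<^sub>I \<alpha> \<^bold>\<rightarrow> \<beta>" "\<Delta> \<in> C" "\<Delta> \<turnstile>\<^sub>b\<^sub>I \<alpha>"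
      by blast
    then have "\<Theta> \<subseteq> \<Delta> \<or> \<Delta> \<subseteq> \<Theta>"
      using chain by (auto simp: subset_chain_def)
    then show ?case
      using D mono bI_modus_ponens by blast
  qed
qed

definition relatively_maximal :: "'v fm \<Rightarrow> 'v fm set \<Rightarrow> bool" where
  "relatively_maximal \<phi> \<Delta> \<longleftrightarrow>
     \<not> \<Delta> \<turnstile>\<^sub>b\<^sub>I \<phi> \<and> (\<forall>\<alpha>. \<alpha> \<notin> \<Delta> \<longrightarrow> insert \<alpha> \<Delta> \<turnstile>\<^sub>b\<^sub>I \<phi>)"

lemma relatively_maximal_extension:
  assumes "\<not> \<Gamma> \<turnstile>\<^sub>b\<^sub>I \<phi>"
  obtains \<Delta> where "\<Gamma> \<subseteq> \<Delta>" "relatively_maximal \<phi> \<Delta>"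
proof -
  let ?A = "{\<Delta>. \<Gamma> \<subseteq> \<Delta> \<and> \<not> \<Delta> \<turnstile>\<^sub>b\<^sub>I \<phi>}"
  have "\<Union>C \<in> ?A" if "C \<noteq> {}" "subset.chain ?A C" for C
    using that bI_derivable_Union_chain[OF that(2,1), of \<phi>]
    by (auto simp: subset_chain_def)
  moreover have "?A \<noteq> {}" using assms by blast
  ultimately obtain \<Delta> where \<Delta>: "\<Delta> \<in> ?A" "\<forall>X\<in>?A. \<Delta> \<subseteq> X \<longrightarrow> X = \<Delta>"
    using subset_Zorn_nonempty[of ?A] by blast
  then have "relatively_maximal \<phi> \<Delta>"
    unfolding relatively_maximal_def by blast
  with \<Delta>(1) show ?thesis by (intro that) auto
qed

context
  fixes \<phi> :: "'v fm" and \<Delta> :: "'v fm set"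
  assumes max: "relatively_maximal \<phi> \<Delta>"
begin

text \<open>
  The deduction theorem turns maximality into negation completeness, with \<open>\<alpha> \<^bold>\<rightarrow> \<phi>\<close> as the negation
  of \<open>\<alpha>\<close>.
\<close>

lemma not_mem_iff_derives_imp: "\<alpha> \<notin> \<Delta> \<longleftrightarrow> \<Delta> \<turnstile>\<^sub>b\<^sub>I \<alpha> \<^bold>\<rightarrow> \<phi>"
  using max bI_deduction bI_modus_ponens bI_premise
  unfolding relatively_maximal_def by blast

lemma mem_iff_derivable: "\<alpha> \<in> \<Delta> \<longleftrightarrow> \<Delta> \<turnstile>\<^sub>b\<^sub>I \<alpha>"
  using max not_mem_iff_derives_imp bI_modus_ponens bI_premise
  unfolding relatively_maximal_def by blast

lemma axiom_mem: "\<alpha> \<in> bI_axioms \<Longrightarrow> \<alpha> \<in> \<Delta>"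
  by (simp add: mem_iff_derivable bI_axiom)

lemma modus_ponens_mem: "\<alpha> \<^bold>\<rightarrow> \<beta> \<in> \<Delta> \<Longrightarrow> \<alpha> \<in> \<Delta> \<Longrightarrow> \<beta> \<in> \<Delta>"
  using mem_iff_derivable bI_modus_ponens by blast

text \<open>
  For primeness, take \<open>\<phi>\<close> as the conclusion of the proof by cases in Ax8: if each disjunct implied
  \<open>\<phi>\<close>, so would the disjunction.
\<close>

lemma Or_mem_iff: "\<alpha> \<^bold>\<or> \<beta> \<in> \<Delta> \<longleftrightarrow> \<alpha> \<in> \<Delta> \<or> \<beta> \<in> \<Delta>"
proof
  assume "\<alpha> \<^bold>\<or> \<beta> \<in> \<Delta>"
  then show "\<alpha> \<in> \<Delta> \<or> \<beta> \<in> \<Delta>"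
    using not_mem_iff_derives_imp bI_axiom[OF Ax8] bI_modus_ponens by blast
qed (use modus_ponens_mem axiom_mem Ax6 Ax7 in blast)

lemma And_mem_iff: "\<alpha> \<^bold>\<and> \<beta> \<in> \<Delta> \<longleftrightarrow> \<alpha> \<in> \<Delta> \<and> \<beta> \<in> \<Delta>"
  using modus_ponens_mem axiom_mem Ax3 Ax4 Ax5 by blast

lemma Imp_mem_iff: "\<alpha> \<^bold>\<rightarrow> \<beta> \<in> \<Delta> \<longleftrightarrow> \<alpha> \<notin> \<Delta> \<or> \<beta> \<in> \<Delta>"
proof
  assume "\<alpha> \<notin> \<Delta> \<or> \<beta> \<in> \<Delta>"
  then show "\<alpha> \<^bold>\<rightarrow> \<beta> \<in> \<Delta>"
  proof
    assume "\<alpha> \<notin> \<Delta>"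
    then show ?thesis using axiom_mem[OF Ax9] Or_mem_iff by blast
  next
    assume "\<beta> \<in> \<Delta>"
    then show ?thesis using axiom_mem[OF Ax1] modus_ponens_mem by blast
  qed
qed (use modus_ponens_mem in blast)

lemma Incomp_mem_explosive: "\<alpha> \<^bold>\<up> \<beta> \<in> \<Delta> \<Longrightarrow> \<alpha> \<notin> \<Delta> \<or> \<beta> \<notin> \<Delta>"
proof -
  have "\<phi> \<notin> \<Delta>" using not_mem_iff_derives_imp bI_imp_refl by blast
  then show "\<alpha> \<^bold>\<up> \<beta> \<in> \<Delta> \<Longrightarrow> \<alpha> \<notin> \<Delta> \<or> \<beta> \<notin> \<Delta>"
    using axiom_mem[OF Ip] modus_ponens_mem by blast
qed

lemma Incomp_mem_commute: "\<alpha> \<^bold>\<up> \<beta> \<in> \<Delta> \<longleftrightarrow> \<beta> \<^bold>\<up> \<alpha> \<in> \<Delta>"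
  using axiom_mem[OF Comm] modus_ponens_mem by blast

lemma bivaluation_of_relatively_maximal: "bI_bivaluation (\<lambda>\<alpha>. \<alpha> \<in> \<Delta>)"
  unfolding bI_bivaluation_def
  using Or_mem_iff And_mem_iff Imp_mem_iff Incomp_mem_explosive Incomp_mem_commute by auto

end

theorem bI_completeness:
  assumes "\<Gamma> \<Turnstile>\<^sub>b\<^sub>I \<phi>"
  shows "\<Gamma> \<turnstile>\<^sub>b\<^sub>I \<phi>"
proof (rule ccontr)
  assume "\<not> \<Gamma> \<turnstile>\<^sub>b\<^sub>I \<phi>"
  then obtain \<Delta> where \<Delta>: "\<Gamma> \<subseteq> \<Delta>" "relatively_maximal \<phi> \<Delta>"
    by (rule relatively_maximal_extension)
  then have "\<phi> \<in> \<Delta>"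
    using assms bivaluation_of_relatively_maximal unfolding bI_entails_def by blast
  then show False
    using \<Delta>(2) bI_premise unfolding relatively_maximal_def by blast
qed

theorem theorem1:
  fixes \<Gamma> :: "'v::countable fm set" and \<phi> :: "'v fm"
  shows "\<Gamma> \<turnstile>\<^sub>b\<^sub>I \<phi> \<longleftrightarrow> \<Gamma> \<Turnstile>\<^sub>b\<^sub>I \<phi>"
  using bI_soundness bI_completeness by blast

end
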